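(* For every infinite cardinal $\kappa$ and every $n\in\mathbb{N}$ there is a primitive graph with distance sequence $1,\kappa,\dots,\kappa$, where $\kappa$ appears $n$ times (that is, a primitive graph of diameter $n$ in which, for every vertex $v$ and every $1\le i\le n$, exactly $\kappa$ vertices are at distance $i$ from $v$).
   Context: Graphs are simple and undirected, with vertex set $V(\Gamma)$. A graph $\Gamma$ is primitive if its automorphism group acts primitively on $V(\Gamma)$, i.e. the only equivalence relations on $V(\Gamma)$ invariant under $\mathrm{Aut}(\Gamma)$ are the trivial ones (equality and the universal relation). For a vertex-transitive graph, the distance sequence is $d(0),d(1),d(2),\dots$, where $d(i)$ is the (cardinal) number of vertices at graph distance exactly $i$ from a fixed vertex $v$; it does not depend on $v$. If the diameter is finite, equal to $n$, the sequence is the finite list $d(0),\dots,d(n)$. *)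

theory Defs
  imports Main "HOL-Library.Extended_Nat"
begin

unbundle cardinal_syntax

definition simple_graph :: "'a set \<Rightarrow> ('a \<Rightarrow> 'a \<Rightarrow> bool) \<Rightarrow> bool" where
  "simple_graph V E \<longleftrightarrow>
     (\<forall>u v. E u v \<longrightarrow> u \<in> V \<and> v \<in> V) \<and> (\<forall>u. \<not> E u u) \<and> (\<forall>u v. E u v \<longrightarrow> E v u)"

(* Only the values on V matter: an automorphism may do anything outside V. *)
definition automorphisms :: "'a set \<Rightarrow> ('a \<Rightarrow> 'a \<Rightarrow> bool) \<Rightarrow> ('a \<Rightarrow> 'a) set" where
  "automorphisms V E = {f. bij_betw f V V \<and> (\<forall>u\<in>V. \<forall>v\<in>V. E (f u) (f v) \<longleftrightarrow> E u v)}"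

definition primitive_graph :: "'a set \<Rightarrow> ('a \<Rightarrow> 'a \<Rightarrow> bool) \<Rightarrow> bool" where
  "primitive_graph V E \<longleftrightarrow>
     simple_graph V E \<and>
     (\<forall>r. equiv V r \<and> (\<forall>f\<in>automorphisms V E. \<forall>(x, y)\<in>r. (f x, f y) \<in> r)
        \<longrightarrow> r = Id_on V \<or> r = V \<times> V)"

definition walks :: "'a set \<Rightarrow> ('a \<Rightarrow> 'a \<Rightarrow> bool) \<Rightarrow> 'a \<Rightarrow> 'a \<Rightarrow> 'a list set" where
  "walks V E u v =
     {p. p \<noteq> [] \<and> set p \<subseteq> V \<and> hd p = u \<and> last p = v \<and> successively E p}"

(* A walk is the list of its vertices, so it has length p - 1 edges.  The infimum of the empty
   set is \<infinity>, which is the distance between vertices in different components. *)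
definition graph_dist :: "'a set \<Rightarrow> ('a \<Rightarrow> 'a \<Rightarrow> bool) \<Rightarrow> 'a \<Rightarrow> 'a \<Rightarrow> enat" where
  "graph_dist V E u v = (INF p\<in>walks V E u v. enat (length p - 1))"

definition diameter :: "'a set \<Rightarrow> ('a \<Rightarrow> 'a \<Rightarrow> bool) \<Rightarrow> enat" where
  "diameter V E = (SUP u\<in>V. SUP v\<in>V. graph_dist V E u v)"

definition sphere :: "'a set \<Rightarrow> ('a \<Rightarrow> 'a \<Rightarrow> bool) \<Rightarrow> 'a \<Rightarrow> nat \<Rightarrow> 'a set" where
  "sphere V E v i = {u \<in> V. graph_dist V E v u = enat i}"

end

theory Submission
  imports Defs "HOL-Library.FuncSet" "HOL-Combinatorics.Transposition"
begin

text \<open>The Hamming graph \<open>H(n, \<kappa>)\<close> works: its vertices are the \<open>n\<close>-tuples over a set of size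
  \<open>\<kappa>\<close>, two of them adjacent when they differ in exactly one coordinate, and graph distance is Hamming
  distance. Permuting coordinates, and the values within each coordinate, makes it distance
  transitive. If an invariant equivalence relation contains \<open>(x, y)\<close> with \<open>x \<noteq> y\<close>, change
  one coordinate in which they differ to a third value; the result \<open>y'\<close> is at the same distance from
  \<open>x\<close> as \<open>y\<close>, so \<open>(x, y')\<close> and hence the adjacent pair \<open>(y, y')\<close> lie in the relation. Then all adjacent
  pairs do, and the relation is universal by connectedness.\<close>

section \<open>Extending partial bijections, and the size of a finite power\<close>

lemma bij_betw_matching_two_points:
  assumes "a \<in> A" "a' \<in> A" "b \<in> A" "b' \<in> A" and "a = a' \<longleftrightarrow> b = b'"
  shows "\<exists>\<sigma>. bij_betw \<sigma> A A \<and> \<sigma> a = b \<and> \<sigma> a' = b'"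
proof -
  define \<tau> where "\<tau> = transpose a b"
  \<comment> \<open>After \<open>\<tau>\<close> has sent \<open>a\<close> to \<open>b\<close>, a
    second swap corrects the image of \<open>a'\<close>. It fixes \<open>b\<close>: if
    \<open>a\<close> and \<open>a'\<close> are distinct, then \<open>b\<close> differs from both
    swapped points, and otherwise the swap is the identity.\<close>
  define \<sigma> where "\<sigma> = transpose (\<tau> a') b' \<circ> \<tau>"
  have \<tau>: "bij_betw \<tau> A A" "\<tau> a = b" "\<tau> a' \<in> A"
    using assms by (auto simp: \<tau>_def transpose_def)
  moreover have "bij_betw (transpose (\<tau> a') b') A A"
    using \<tau> assms by simp
  ultimately have "bij_betw \<sigma> A A"
    unfolding \<sigma>_def by (blast intro: bij_betw_trans)
  moreover have "\<sigma> a = b"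
    using assms by (auto simp: \<sigma>_def \<tau>_def transpose_def)
  moreover have "\<sigma> a' = b'"
    by (simp add: \<sigma>_def)
  ultimately show ?thesis
    by blast
qed

text \<open>Since \<open>I\<close> is finite, the complements of \<open>S\<close> and
  \<open>T\<close> are equinumerous too, so a bijection between the sets and one between the
  complements glue together.\<close>

lemma bij_betw_extend_finite:
  assumes "finite I" "S \<subseteq> I" "T \<subseteq> I" "card S = card T"
  shows "\<exists>\<pi>. bij_betw \<pi> I I \<and> (\<forall>i\<in>I. \<pi> i \<in> T \<longleftrightarrow> i \<in> S)"
proof -
  have fin: "finite S" "finite T" "finite (I - S)" "finite (I - T)"
    using assms finite_subset by auto
  then have "card (I - S) = card (I - T)"
    using assms by (simp add: card_Diff_subset)
  then obtain f g where f: "bij_betw f S T" and g: "bij_betw g (I - S) (I - T)"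
    using fin assms(4) finite_same_card_bij by metis
  define \<pi> where "\<pi> i = (if i \<in> S then f i else g i)" for i
  have "bij_betw \<pi> (S \<union> (I - S)) (T \<union> (I - T))"
    unfolding \<pi>_def by (rule bij_betw_disjoint_Un[OF f g]) auto
  moreover have "S \<union> (I - S) = I" "T \<union> (I - T) = I"
    using assms by auto
  moreover have "\<forall>i\<in>I. \<pi> i \<in> T \<longleftrightarrow> i \<in> S"
    using f g by (auto simp: \<pi>_def bij_betw_def)
  ultimately show ?thesis
    by auto
qed

text \<open>Each new coordinate multiplies by \<open>A\<close>, which an infinite cardinal absorbs.
  This bounds the spheres from above and lets the tuples be encoded as elements of the type of
  \<open>A\<close>.\<close>

lemma card_of_PiE_finite_ordLeq:
  assumes "finite I" "infinite A"
  shows "|I \<rightarrow>\<^sub>E A| \<le>o |A|"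
  using assms(1)
proof induction
  case empty
  then show ?case
    using assms(2) by (auto intro!: card_of_singl_ordLeq)
next
  case (insert i I)
  have "|insert i I \<rightarrow>\<^sub>E A| \<le>o |A \<times> (I \<rightarrow>\<^sub>E A)|"
    by (subst PiE_insert_eq) (rule card_of_image)
  also have "|A \<times> (I \<rightarrow>\<^sub>E A)| \<le>o |A|"
    using assms(2) insert.IH
    by (intro card_of_Times_ordLeq_infinite_Field)
      (simp_all add: Field_card_of card_of_mono1 card_of_card_order_on)
  finally show ?case .
qed

text \<open>The coordinate map \<open>c\<close> allows the vertex set to be a subset of any type that is large enough.\<close>

locale hamming_graph =
  fixes I :: "'i set" and A :: "'b set" and V :: "'v set" and c :: "'v \<Rightarrow> 'i \<Rightarrow> 'b"
  assumes finite_I: "finite I"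
    and infinite_A: "infinite A"
    and bij_c: "bij_betw c V (I \<rightarrow>\<^sub>E A)"
begin

text \<open>Its cardinality is the Hamming distance; the set itself is kept because coordinate
  permutations act on it.\<close>

definition diff :: "'v \<Rightarrow> 'v \<Rightarrow> 'i set" where
  "diff u v = {i \<in> I. c u i \<noteq> c v i}"

definition E :: "'v \<Rightarrow> 'v \<Rightarrow> bool" where
  "E u v \<longleftrightarrow> u \<in> V \<and> v \<in> V \<and> card (diff u v) = 1"

lemma c_mem: "v \<in> V \<Longrightarrow> i \<in> I \<Longrightarrow> c v i \<in> A"
  using bij_c by (auto simp: bij_betw_def)

lemma vertex_eqI:
  assumes "u \<in> V" "v \<in> V" "\<And>i. i \<in> I \<Longrightarrow> c u i = c v i"
  shows "u = v"
proof -
  have "c u = c v"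
    using assms bij_c by (intro PiE_ext[of _ I "\<lambda>_. A"]) (auto simp: bij_betw_def)
  then show ?thesis
    using assms bij_c by (auto simp: bij_betw_def inj_on_def)
qed

lemma ex_vertex:
  assumes "\<And>i. i \<in> I \<Longrightarrow> f i \<in> A"
  shows "\<exists>v\<in>V. \<forall>i\<in>I. c v i = f i"
proof -
  have "restrict f I \<in> c ` V"
    using assms bij_c by (auto simp: bij_betw_def)
  then obtain v where "v \<in> V" "c v = restrict f I"
    by auto
  then show ?thesis
    by (intro bexI[of _ v]) auto
qed

lemma V_nonempty: "V \<noteq> {}"
proof -
  obtain a where "a \<in> A"
    using infinite_A by fastforce
  then show ?thesis
    using ex_vertex[of "\<lambda>_. a"] by auto
qed

lemma ex_other: "finite S \<Longrightarrow> \<exists>a\<in>A. a \<notin> S"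
  using infinite_A by (meson finite_subset subsetI)

lemma ex_vertex_upd:
  assumes "u \<in> V" "a \<in> A" "j \<in> I"
  shows "\<exists>v\<in>V. c v j = a \<and> (\<forall>i\<in>I - {j}. c v i = c u i)"
proof -
  have "\<exists>v\<in>V. \<forall>i\<in>I. c v i = (if i = j then a else c u i)"
    using assms by (intro ex_vertex) (auto simp: c_mem)
  then show ?thesis
    using assms(3) by (metis DiffE insertI1)
qed

section \<open>Hamming distance is graph distance\<close>

lemma diff_subset: "diff u v \<subseteq> I"
  by (auto simp: diff_def)

lemma finite_diff: "finite (diff u v)"
  using finite_I diff_subset finite_subset by blast

lemma diff_self: "diff v v = {}"
  by (simp add: diff_def)

lemma diff_commute: "diff u v = diff v u"
  by (auto simp: diff_def)

lemma diff_empty_iff: "u \<in> V \<Longrightarrow> v \<in> V \<Longrightarrow> diff u v = {} \<longleftrightarrow> u = v"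
  using vertex_eqI by (auto simp: diff_def)

lemma card_diff_triangle: "card (diff u w) \<le> card (diff u v) + card (diff v w)"
proof -
  have "card (diff u w) \<le> card (diff u v \<union> diff v w)"
    by (intro card_mono) (auto simp: finite_diff, auto simp: diff_def)
  also have "\<dots> \<le> card (diff u v) + card (diff v w)"
    by (rule card_Un_le)
  finally show ?thesis .
qed

lemma simple_graph: "simple_graph V E"
  by (auto simp: simple_graph_def E_def diff_commute) (auto simp: diff_def)

text \<open>Overwriting one wrong coordinate of \<open>u\<close> by that of \<open>w\<close> is a
  step along an edge. Iterated, this gives shortest walks and, later, connectedness.\<close>

lemma ex_closer_neighbour:
  assumes "u \<in> V" "w \<in> V" "card (diff u w) = Suc k"
  shows "\<exists>v\<in>V. E u v \<and> card (diff v w) = k"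
proof -
  obtain j where j: "j \<in> diff u w"
    using assms(3) by fastforce
  then obtain v where v: "v \<in> V" "c v j = c w j" "\<And>i. i \<in> I \<Longrightarrow> i \<noteq> j \<Longrightarrow> c v i = c u i"
    using ex_vertex_upd[of u "c w j" j] assms by (fastforce simp: diff_def c_mem)
  have "diff u v = {j}" "diff v w = diff u w - {j}"
    using v(2,3) j unfolding diff_def by force+
  then show ?thesis
    using v(1) assms j finite_diff by (intro bexI[of _ v]) (auto simp: E_def)
qed

lemma ex_walk:
  assumes "u \<in> V" "w \<in> V"
  shows "\<exists>p\<in>walks V E u w. length p - 1 = card (diff u w)"
  using assms
proof (induction "card (diff u w)" arbitrary: u)
  case 0
  then have "u = w"
    using finite_diff diff_empty_iff by (metis card_0_eq)
  then show ?case
    using 0 by (intro bexI[of _ "[u]"]) (auto simp: walks_def)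
next
  case (Suc k)
  then obtain v where v: "v \<in> V" "E u v" "card (diff v w) = k"
    using ex_closer_neighbour by metis
  then obtain p where p: "p \<in> walks V E v w" "length p - 1 = k"
    using Suc by metis
  then have "u # p \<in> walks V E u w"
    using Suc.prems v by (auto simp: walks_def successively_Cons)
  moreover have "length (u # p) - 1 = Suc k"
    using p by (cases p) (auto simp: walks_def)
  ultimately show ?case
    using Suc.hyps(2) by metis
qed

text \<open>By the triangle inequality, each edge adds at most one to the Hamming distance from
  start to end.\<close>

lemma walk_length_ge:
  assumes "p \<noteq> []" "successively E p"
  shows "card (diff (hd p) (last p)) \<le> length p - 1"
  using assms
proof (induction p)
  case Nil
  then show ?case by simp
next
  case (Cons u p)
  show ?case
  proof (cases "p = []")
    case True
    then show ?thesis by (simp add: diff_def)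
  next
    case False
    then have "card (diff (hd p) (last p)) \<le> length p - 1" "card (diff u (hd p)) = 1"
      using Cons by (auto simp: successively_Cons E_def)
    moreover have "length p > 0"
      using False by simp
    ultimately have "card (diff u (last p)) \<le> length p"
      using card_diff_triangle[of u "last p" "hd p"] by linarith
    then show ?thesis
      using False by simp
  qed
qed

lemma graph_dist_eq:
  assumes "u \<in> V" "v \<in> V"
  shows "graph_dist V E u v = enat (card (diff u v))"
proof (rule antisym)
  show "graph_dist V E u v \<le> enat (card (diff u v))"
    using ex_walk[OF assms] unfolding graph_dist_def by (metis INF_lower)
  show "enat (card (diff u v)) \<le> graph_dist V E u v"
    unfolding graph_dist_def
    using walk_length_ge by (intro INF_greatest) (auto simp: walks_def)
qed

section \<open>Automorphisms, distance transitivity and primitivity\<close>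

lemma ex_automorphism:
  assumes \<pi>: "bij_betw \<pi> I I" and \<sigma>: "\<And>i. i \<in> I \<Longrightarrow> bij_betw (\<sigma> i) A A"
  shows "\<exists>f\<in>automorphisms V E. \<forall>u\<in>V. f u \<in> V \<and> (\<forall>i\<in>I. c (f u) i = \<sigma> i (c u (\<pi> i)))"
proof -
  have \<pi>_mem: "\<pi> i \<in> I" if "i \<in> I" for i
    using \<pi> that by (auto simp: bij_betw_def)
  have "\<exists>v\<in>V. \<forall>i\<in>I. c v i = \<sigma> i (c u (\<pi> i))" if "u \<in> V" for u
    by (rule ex_vertex) (use that \<sigma> \<pi>_mem c_mem bij_betwE in blast)
  then obtain f where f: "\<And>u. u \<in> V \<Longrightarrow> f u \<in> V"
      "\<And>u i. u \<in> V \<Longrightarrow> i \<in> I \<Longrightarrow> c (f u) i = \<sigma> i (c u (\<pi> i))"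
    by metis
  have eq_iff: "c (f u) i = c (f v) i \<longleftrightarrow> c u (\<pi> i) = c v (\<pi> i)"
    if "u \<in> V" "v \<in> V" "i \<in> I" for u v i
    using that f \<sigma>[of i] c_mem \<pi>_mem by (auto simp: bij_betw_def inj_on_def)
  \<comment> \<open>\<open>\<pi>\<close> carries the coordinates where \<open>f u\<close> and
    \<open>f v\<close> differ onto those where \<open>u\<close> and \<open>v\<close> differ.
    Preserving Hamming distance then gives both adjacency and injectivity.\<close>
  have card_eq: "card (diff (f u) (f v)) = card (diff u v)" if "u \<in> V" "v \<in> V" for u v
  proof (rule bij_betw_same_card[of \<pi>], rule bij_betw_subset[OF \<pi> diff_subset])
    show "\<pi> ` diff (f u) (f v) = diff u v"
    proof (intro equalityI subsetI)
      fix i assume i: "i \<in> diff u v"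
      then obtain k where "k \<in> I" "i = \<pi> k"
        using \<pi> by (auto simp: diff_def bij_betw_def)
      then show "i \<in> \<pi> ` diff (f u) (f v)"
        using i eq_iff that by (auto simp: diff_def)
    qed (use eq_iff that \<pi>_mem in \<open>auto simp: diff_def\<close>)
  qed
  have "inj_on f V"
  proof (rule inj_onI)
    fix u v assume uv: "u \<in> V" "v \<in> V" "f u = f v"
    then have "card (diff u v) = 0"
      using card_eq[of u v] by (simp add: diff_def)
    then show "u = v"
      using uv diff_empty_iff finite_diff by (metis card_0_eq)
  qed
  moreover have "w \<in> f ` V" if w: "w \<in> V" for w
  proof -
    \<comment> \<open>For surjectivity, \<open>\<sigma> k (c u (\<pi> k)) = c w k\<close> is solved
      for \<open>u\<close>; at the index \<open>i = \<pi> k\<close> this prescribes a preimage of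
      \<open>c w (g i)\<close> under \<open>\<sigma> (g i)\<close>.\<close>
    define g where "g i = inv_into I \<pi> i" for i
    have g: "g i \<in> I" "\<pi> (g i) = i" "g (\<pi> i) = i" if "i \<in> I" for i
      using that \<pi> by (auto simp: g_def bij_betw_def inv_into_into f_inv_into_f)
    have "inv_into A (\<sigma> (g i)) (c w (g i)) \<in> A" if "i \<in> I" for i
      using that g \<sigma>[of "g i"] c_mem[OF w] by (simp add: bij_betw_def inv_into_into)
    then obtain u where u: "u \<in> V" "\<And>i. i \<in> I \<Longrightarrow> c u i = inv_into A (\<sigma> (g i)) (c w (g i))"
      using ex_vertex[of "\<lambda>i. inv_into A (\<sigma> (g i)) (c w (g i))"] by auto
    have "f u = w"
    proof (rule vertex_eqI)
      fix i assume i: "i \<in> I"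
      then show "c (f u) i = c w i"
        using u g f \<pi>_mem \<sigma>[of i] c_mem[OF w] by (simp add: bij_betw_def f_inv_into_f)
    qed (use u w f in auto)
    then show ?thesis
      using u by blast
  qed
  ultimately have "bij_betw f V V"
    using f(1) by (auto simp: bij_betw_def)
  then have "f \<in> automorphisms V E"
    using card_eq f(1) by (auto simp: automorphisms_def E_def)
  then show ?thesis
    using f by blast
qed

lemma distance_transitive:
  assumes "x \<in> V" "y \<in> V" "u \<in> V" "w \<in> V" and "card (diff x y) = card (diff u w)"
  shows "\<exists>f\<in>automorphisms V E. f x = u \<and> f y = w"
proof -
  \<comment> \<open>With this \<open>\<pi>\<close>, \<open>x\<close> and \<open>y\<close> agree at
    \<open>\<pi> i\<close> exactly when \<open>u\<close> and \<open>w\<close> agree at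
    \<open>i\<close>, which is what allows a permutation of values to match both pairs at
    once.\<close>
  obtain \<pi> where \<pi>: "bij_betw \<pi> I I" "\<And>i. i \<in> I \<Longrightarrow> \<pi> i \<in> diff x y \<longleftrightarrow> i \<in> diff u w"
    using bij_betw_extend_finite[OF finite_I, of "diff u w" "diff x y"] assms(5) diff_subset by auto
  have "\<exists>s. bij_betw s A A \<and> s (c x (\<pi> i)) = c u i \<and> s (c y (\<pi> i)) = c w i" if "i \<in> I" for i
  proof (rule bij_betw_matching_two_points)
    have "\<pi> i \<in> I"
      using \<pi>(1) that by (auto simp: bij_betw_def)
    then show "c x (\<pi> i) \<in> A" "c y (\<pi> i) \<in> A" "c x (\<pi> i) = c y (\<pi> i) \<longleftrightarrow> c u i = c w i"
      using \<pi>(2)[OF that] assms that by (auto simp: diff_def c_mem)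
  qed (use that assms c_mem in auto)
  then obtain \<sigma> where \<sigma>: "\<And>i. i \<in> I \<Longrightarrow> bij_betw (\<sigma> i) A A"
      "\<And>i. i \<in> I \<Longrightarrow> \<sigma> i (c x (\<pi> i)) = c u i" "\<And>i. i \<in> I \<Longrightarrow> \<sigma> i (c y (\<pi> i)) = c w i"
    by metis
  obtain f where f: "f \<in> automorphisms V E"
      "\<And>v. v \<in> V \<Longrightarrow> f v \<in> V \<and> (\<forall>i\<in>I. c (f v) i = \<sigma> i (c v (\<pi> i)))"
    using ex_automorphism[of \<pi> \<sigma>, OF \<pi>(1) \<sigma>(1)] by blast
  have "f x = u" "f y = w"
    using f(2) assms \<sigma> by (auto intro!: vertex_eqI)
  then show ?thesis
    using f(1) by blast
qed

lemma primitive: "primitive_graph V E"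
  unfolding primitive_graph_def
proof (intro conjI allI impI simple_graph)
  fix r
  assume "equiv V r \<and> (\<forall>f\<in>automorphisms V E. \<forall>(x, y)\<in>r. (f x, f y) \<in> r)"
  then have r: "equiv V r"
    and inv: "\<And>f x y. f \<in> automorphisms V E \<Longrightarrow> (x, y) \<in> r \<Longrightarrow> (f x, f y) \<in> r"
    by auto
  have r_sub: "r \<subseteq> V \<times> V" and r_refl: "\<And>x. x \<in> V \<Longrightarrow> (x, x) \<in> r"
    and r_sym: "\<And>x y. (x, y) \<in> r \<Longrightarrow> (y, x) \<in> r"
    and r_trans: "\<And>x y z. (x, y) \<in> r \<Longrightarrow> (y, z) \<in> r \<Longrightarrow> (x, z) \<in> r"
    using r by (auto elim!: equivE simp: refl_on_def dest: symD transD)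
  \<comment> \<open>An invariant relation is a union of distance classes.\<close>
  have same_dist: "(u, w) \<in> r"
    if "(x, y) \<in> r" "u \<in> V" "w \<in> V" "card (diff x y) = card (diff u w)" for x y u w
    using distance_transitive[of x y u w] inv[OF _ that(1)] that r_sub by blast
  show "r = Id_on V \<or> r = V \<times> V"
  proof (cases "r \<subseteq> Id_on V")
    case True
    then show ?thesis
      using r_refl by blast
  next
    case False
    then obtain x y where xy: "(x, y) \<in> r" "x \<in> V" "y \<in> V" "x \<noteq> y"
      using r_sub by auto
    then obtain j where j: "j \<in> diff x y"
      using diff_empty_iff by blast
    \<comment> \<open>Avoiding \<open>c x j\<close> keeps \<open>j\<close> among the differences
      from \<open>x\<close>; avoiding \<open>c y j\<close> makes \<open>y'\<close> a neighbour of
      \<open>y\<close>.\<close>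
    obtain z where z: "z \<in> A" "z \<notin> {c x j, c y j}"
      using ex_other[of "{c x j, c y j}"] by auto
    obtain y' where y': "y' \<in> V" "c y' j = z" "\<And>i. i \<in> I \<Longrightarrow> i \<noteq> j \<Longrightarrow> c y' i = c y i"
      using ex_vertex_upd[of y z j] xy z j diff_subset by fastforce
    have "diff x y' = diff x y" "diff y y' = {j}"
      using y'(2,3) j z unfolding diff_def by force+
    then have "(x, y') \<in> r"
      using same_dist[OF xy(1)] xy y' by simp
    then have yy': "(y, y') \<in> r"
      using xy r_sym r_trans by blast
    then have adj: "(u, v) \<in> r" if "E u v" for u v
      using same_dist[OF yy'] that \<open>diff y y' = {j}\<close> by (simp add: E_def)
    have "(u, w) \<in> r" if "u \<in> V" "w \<in> V" for u w
      using that
    proof (induction "card (diff u w)" arbitrary: u)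
      case 0
      then show ?case
        using finite_diff diff_empty_iff r_refl by (metis card_0_eq)
    next
      case (Suc k)
      then show ?case
        using ex_closer_neighbour adj r_trans by metis
    qed
    then show ?thesis
      using r_sub by auto
  qed
qed

section \<open>Diameter and sizes of spheres\<close>

lemma ex_antipode: "\<exists>b. \<forall>i\<in>I. b i \<in> A \<and> b i \<noteq> c u i"
proof -
  have "\<exists>a. a \<in> A \<and> a \<noteq> c u i" for i
    using ex_other[of "{c u i}"] by auto
  then show ?thesis
    by metis
qed

lemma diameter_eq: "diameter V E = enat (card I)"
proof (rule antisym)
  show "diameter V E \<le> enat (card I)"
    unfolding diameter_def
    by (auto intro!: SUP_least simp: graph_dist_eq card_mono diff_subset finite_I)
  obtain u where u: "u \<in> V"
    using V_nonempty by blast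
  obtain v where v: "v \<in> V" "\<forall>i\<in>I. c u i \<noteq> c v i"
    using ex_antipode[of u] ex_vertex by metis
  then have "diff u v = I"
    by (auto simp: diff_def)
  then have "enat (card I) = graph_dist V E u v"
    using u v by (simp add: graph_dist_eq)
  also have "\<dots> \<le> diameter V E"
    unfolding diameter_def using u v by (blast intro: SUP_upper2)
  finally show "enat (card I) \<le> diameter V E" .
qed

lemma sphere_eq: "v \<in> V \<Longrightarrow> sphere V E v k = {u \<in> V. card (diff v u) = k}"
  by (auto simp: sphere_def graph_dist_eq)

lemma sphere_0: "v \<in> V \<Longrightarrow> sphere V E v 0 = {v}"
  by (auto simp: sphere_eq finite_diff diff_empty_iff diff_self)

lemma card_of_sphere:
  assumes v: "v \<in> V" and k: "k \<in> {1..card I}"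
  shows "|sphere V E v k| =o |A|"
proof -
  have "|V| =o |I \<rightarrow>\<^sub>E A|"
    using bij_c card_of_ordIso by blast
  then have "|V| \<le>o |A|"
    using card_of_PiE_finite_ordLeq[OF finite_I infinite_A] ordIso_ordLeq_trans by blast
  moreover have "|sphere V E v k| \<le>o |V|"
    by (rule card_of_mono1) (auto simp: sphere_def)
  ultimately have upper: "|sphere V E v k| \<le>o |A|"
    using ordLeq_transitive by blast
  obtain J where J: "J \<subseteq> I" "card J = k"
    using k obtain_subset_with_card_n[of k I] by auto
  \<comment> \<open>Here \<open>k\<close> being at least 1 matters: \<open>J\<close> needs a
    coordinate that can vary freely.\<close>
  then obtain j where j: "j \<in> J"
    using k by fastforce
  obtain b where b: "\<forall>i\<in>I. b i \<in> A \<and> b i \<noteq> c v i"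
    using ex_antipode[of v] by blast
  \<comment> \<open>For the lower bound, coordinate \<open>j\<close> runs through \<open>A\<close>,
    the rest of \<open>J\<close> is moved away from \<open>v\<close> by \<open>b\<close>, and all
    else stays as in \<open>v\<close>. Coordinate \<open>j\<close> recovers \<open>a\<close>, so
    these vertices are distinct; excluding \<open>a = c v j\<close> puts them at distance exactly
    \<open>k\<close>.\<close>
  have "\<exists>u\<in>V. \<forall>i\<in>I. c u i = (if i = j then a else if i \<in> J then b i else c v i)"
    if "a \<in> A" for a
    using that b v by (intro ex_vertex) (auto simp: c_mem)
  then obtain h where h: "\<And>a. a \<in> A \<Longrightarrow> h a \<in> V"
      "\<And>a i. a \<in> A \<Longrightarrow> i \<in> I \<Longrightarrow> c (h a) i = (if i = j then a else if i \<in> J then b i else c v i)"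
    by metis
  have h_j: "c (h a) j = a" if "a \<in> A" for a
    using that h(2) j J by auto
  have "diff v (h a) = J" if "a \<in> A - {c v j}" for a
  proof (rule set_eqI)
    fix i
    show "i \<in> diff v (h a) \<longleftrightarrow> i \<in> J"
      using that j J(1) b h(2)[of a i] by (cases "i \<in> I"; cases "i = j") (auto simp: diff_def)
  qed
  then have "h ` (A - {c v j}) \<subseteq> sphere V E v k"
    using v h J by (auto simp: sphere_eq)
  moreover have "inj_on h (A - {c v j})"
    using h_j by (metis DiffD1 inj_onI)
  ultimately have "|A - {c v j}| \<le>o |sphere V E v k|"
    using card_of_ordLeq by blast
  moreover have "|A| =o |A - {c v j}|"
    using infinite_imp_bij_betw[OF infinite_A] card_of_ordIso by blast
  ultimately show ?thesis
    using upper ordIso_iff_ordLeq ordIso_ordLeq_trans by blast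
qed

end

theorem theorem2p5:
  fixes \<kappa> :: "'a rel" and n :: nat
  assumes "Cinfinite \<kappa>"
  shows "\<exists>(V :: 'a set) E. V \<noteq> {} \<and> primitive_graph V E \<and> diameter V E = enat n \<and>
           (\<forall>v\<in>V. |sphere V E v 0| =o |{v}| \<and> (\<forall>i\<in>{1..n}. |sphere V E v i| =o \<kappa>))"
proof -
  define A where "A = Field \<kappa>"
  define I where "I = {..<n}"
  have A: "infinite A" "|A| =o \<kappa>"
    using assms by (auto simp: A_def cinfinite_def card_of_Field_ordIso)
  have "|I \<rightarrow>\<^sub>E A| \<le>o |A|"
    using A by (simp add: I_def card_of_PiE_finite_ordLeq)
  \<comment> \<open>The vertices must have type \<open>'a\<close>, so \<open>g\<close> encodes
    tuples injectively as elements of \<open>'a\<close>, and its inverse serves as the coordinate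
    map.\<close>
  then obtain g :: "(nat \<Rightarrow> 'a) \<Rightarrow> 'a" where "inj_on g (I \<rightarrow>\<^sub>E A)"
    unfolding card_of_ordLeq[symmetric] by blast
  then have "bij_betw g (I \<rightarrow>\<^sub>E A) (g ` (I \<rightarrow>\<^sub>E A))"
    by (rule inj_on_imp_bij_betw)
  then interpret hamming_graph I A "g ` (I \<rightarrow>\<^sub>E A)" "inv_into (I \<rightarrow>\<^sub>E A) g"
    using A by unfold_locales (simp_all add: I_def bij_betw_inv_into)
  show ?thesis
  proof (intro exI[of _ "g ` (I \<rightarrow>\<^sub>E A)"] exI[of _ E] conjI ballI)
    fix v i assume "v \<in> g ` (I \<rightarrow>\<^sub>E A)" "i \<in> {1..n}"
    then show "|sphere (g ` (I \<rightarrow>\<^sub>E A)) E v i| =o \<kappa>"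
      using card_of_sphere A(2) by (metis I_def card_lessThan ordIso_transitive)
  qed (use V_nonempty primitive diameter_eq in \<open>simp_all add: I_def sphere_0[unfolded I_def] card_of_refl\<close>)
qed

end
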